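(* Let $g \ge 2$ and let $\mathbf{f}_1, \dots, \mathbf{f}_g \in \mathbb{R}^d$ be orthonormal features. Suppose the features activate stochastically, and that when active, feature $k$ takes magnitude $m_k > 0$. Consider tied sparse autoencoders with $g$ latents $\mathbf{l}_1, \dots, \mathbf{l}_g \in \mathbb{R}^d$ ($\mathbf{W}_{\mathrm{enc}} = \mathbf{W}_{\mathrm{dec}}^{\top}$, $\mathbf{W}_{\mathrm{dec}} = [\mathbf{l}_1, \dots, \mathbf{l}_g]$), no biases, and Top-$K$ activation. Let $T_K$ denote the (random) Top-$K$ set under the disentangled sparse autoencoder $\mathbf{l}_k = \mathbf{f}_k$, $k = 1, \dots, g$. Suppose there exist indices $i \neq j$ such that $$\mathbb{P}\bigl(i \in T_K,\ m_j > 0,\ j \notin T_K\bigr) > 0,$$ i.e. with nonzero probability latent $i$ fires, feature $j$ is active, and latent $j$ is excluded from the Top-$K$ set. Then the disentangled sparse autoencoder $(\mathbf{l}_1, \dots, \mathbf{l}_g) = (\mathbf{f}_1, \dots, \mathbf{f}_g)$ is not a local minimum of the expected mean squared error $\mathcal{L}(\mathbf{l}_1,\dots,\mathbf{l}_g) = \mathbb{E}\,\|\mathbf{x} - \hat{\mathbf{x}}\|_2^2$.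
   Context: The random input is $\mathbf{x} = \sum_{k=1}^g m_k \mathbf{f}_k$, where $(m_1, \dots, m_g)$ is a random vector of nonnegative magnitudes with finite second moments, $m_k > 0$ if feature $k$ is active and $m_k = 0$ if it is inactive; no independence between features is assumed. For latents $\mathbf{l}_1, \dots, \mathbf{l}_g$, the tied bias-free sparse autoencoder with Top-$K$ activation ($1 \le K \le g$ an integer) selects, for each input $\mathbf{x}$, the set $T$ of the $K$ indices $k$ with the largest pre-activations $\mathbf{l}_k^\top \mathbf{x}$, and reconstructs $\hat{\mathbf{x}} = \sum_{k \in T} (\mathbf{l}_k^\top \mathbf{x})\, \mathbf{l}_k$ (ties broken by a fixed rule). For the disentangled sparse autoencoder the pre-activations are $\mathbf{f}_k^\top \mathbf{x} = m_k$, so $T_K$ is the set of the $K$ indices with the largest $m_k$. "Latent $k$ fires" means $k$ is in the selected set. *)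

theory Defs
  imports "HOL-Probability.Probability"
begin

definition orthonormal_family :: "real ^ 'd ^ 'g \<Rightarrow> bool" where
  "orthonormal_family f \<longleftrightarrow> (\<forall>a b. f $ a \<bullet> f $ b = (if a = b then 1 else 0))"

definition is_top_set :: "nat \<Rightarrow> real ^ 'g \<Rightarrow> 'g set \<Rightarrow> bool" where
  "is_top_set K v T \<longleftrightarrow> card T = K \<and> (\<forall>a\<in>T. \<forall>b. b \<notin> T \<longrightarrow> v $ b \<le> v $ a)"

text \<open>
  A Top-\<open>K\<close> activation together with its tie-breaking rule: a fixed function of the
  pre-activation vector. No particular tie-breaking rule is singled out. Measurability is required
  so that the selected set is a random set and the expected loss is meaningful; it holds for
  instance for tie-breaking by any fixed priority order of the indices.
\<close>

definition topK_rule :: "nat \<Rightarrow> (real ^ 'g \<Rightarrow> 'g set) \<Rightarrow> bool" where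
  "topK_rule K sel \<longleftrightarrow>
     (\<forall>v. is_top_set K v (sel v)) \<and> sel \<in> borel \<rightarrow>\<^sub>M count_space UNIV"

text \<open>The latents \<open>l\<close> are the columns of the decoder matrix: \<open>l $ k\<close> is the \<open>k\<close>-th latent.\<close>

definition preact :: "real ^ 'd ^ 'g \<Rightarrow> real ^ 'd \<Rightarrow> real ^ 'g" where
  "preact l x = (\<chi> k. l $ k \<bullet> x)"

definition fired :: "(real ^ 'g \<Rightarrow> 'g set) \<Rightarrow> real ^ 'd ^ 'g \<Rightarrow> real ^ 'd \<Rightarrow> 'g set" where
  "fired sel l x = sel (preact l x)"

definition reconstruct ::
  "(real ^ 'g \<Rightarrow> 'g set) \<Rightarrow> real ^ 'd ^ 'g \<Rightarrow> real ^ 'd \<Rightarrow> real ^ 'd" where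
  "reconstruct sel l x = (\<Sum>k\<in>fired sel l x. (l $ k \<bullet> x) *\<^sub>R l $ k)"

definition expected_mse ::
  "'w measure \<Rightarrow> ('w \<Rightarrow> real ^ 'd) \<Rightarrow> (real ^ 'g \<Rightarrow> 'g set) \<Rightarrow> real ^ 'd ^ 'g \<Rightarrow> real" where
  "expected_mse M x sel l = (\<integral>\<omega>. (norm (x \<omega> - reconstruct sel l (x \<omega>)))\<^sup>2 \<partial>M)"

definition sae_input :: "('g \<Rightarrow> 'w \<Rightarrow> real) \<Rightarrow> real ^ 'd ^ 'g \<Rightarrow> 'w \<Rightarrow> real ^ 'd" where
  "sae_input m f \<omega> = (\<Sum>k\<in>UNIV. m k \<omega> *\<^sub>R f $ k)"

definition local_minimum :: "('a::metric_space \<Rightarrow> real) \<Rightarrow> 'a \<Rightarrow> bool" where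
  "local_minimum L w \<longleftrightarrow> (\<exists>\<epsilon>>0. \<forall>w'. dist w' w < \<epsilon> \<longrightarrow> L w \<le> L w')"

end

theory Submission imports Defs begin

text \<open>
  Tilt latent \<open>i\<close> towards \<open>f $ j\<close> and shrink latent \<open>j\<close>, both by \<open>s > 0\<close>. Whenever \<open>i\<close> fires
  and \<open>j\<close> does not, the loss changes by \<open>- 2 s m\<^sub>i m\<^sub>j + O(s\<^sup>2)\<close>; for every other selected set the
  latents only cause an error \<open>O(s\<^sup>2)\<close>. The selected set itself may change, but for each fixed
  input and all small \<open>s\<close> it is still a Top-\<open>K\<close> set of the unperturbed magnitudes, so this costs
  nothing. Shrinking \<open>l $ j\<close> makes sure that on the event of the hypothesis ties are broken against
  \<open>j\<close>, whatever the rule. By dominated convergence, the upper right derivative of the expected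
  loss at \<open>s = 0\<close> is negative.
\<close>

section \<open>Top-K sets: exchange arguments and stability under limits\<close>

text \<open>Exchange argument: equal cardinality gives a bijection from \<open>T' - T\<close> to
  \<open>T - T'\<close>, and \<open>h\<close> weakly increases along it, while the common part
  \<open>T \<inter> T'\<close> contributes equally to both sums.\<close>

lemma is_top_set_sum_mono:
  fixes h :: "'g::finite \<Rightarrow> real"
  assumes "card T = card T'" and "\<And>a b. a \<in> T \<Longrightarrow> b \<notin> T \<Longrightarrow> h b \<le> h a"
  shows "sum h T' \<le> sum h T"
proof -
  have "card (T' - T) = card (T - T')"
    using assms(1) by (simp add: card_Diff_subset_Int Int_commute)
  then obtain p where p: "bij_betw p (T' - T) (T - T')"
    by (meson finite finite_same_card_bij)
  have "sum h (T' - T) \<le> (\<Sum>a\<in>T' - T. h (p a))"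
    using p assms(2) by (intro sum_mono) (auto dest: bij_betwE)
  also have "\<dots> = sum h (T - T')"
    by (rule sum.reindex_bij_betw[OF p])
  finally show ?thesis
    using sum.Int_Diff[of T' h T] sum.Int_Diff[of T h T'] by (simp add: Int_commute)
qed

text \<open>Squaring is monotone on nonnegative entries. This compares losses of different
  selections without knowing how ties were broken; it is applied both to the tilted and to the
  original magnitudes.\<close>

lemma is_top_set_sum_squares_mono:
  fixes v :: "real ^ 'g::finite"
  assumes "is_top_set K v T" and "card T' = K" and "\<And>k. 0 \<le> v $ k"
  shows "(\<Sum>k\<in>T'. (v $ k)\<^sup>2) \<le> (\<Sum>k\<in>T. (v $ k)\<^sup>2)"
  using assms by (intro is_top_set_sum_mono) (auto simp: is_top_set_def intro!: power_mono)

text \<open>If \<open>T'\<close> missed \<open>i\<close>, all its entries would be at least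
  \<open>w $ i\<close>, so \<open>T'\<close> would be a proper subset of \<open>T\<close> of the
  same size. Strictness of the comparison makes the conclusion independent of the tie-breaking
  rule.\<close>

lemma is_top_set_memI:
  fixes w :: "real ^ 'g::finite"
  assumes "is_top_set K w T'" and "card T = K" and "i \<in> T" and "\<And>b. b \<notin> T \<Longrightarrow> w $ b < w $ i"
  shows "i \<in> T'"
proof (rule ccontr)
  assume "i \<notin> T'"
  with assms have "T' \<subset> T"
    unfolding is_top_set_def psubset_eq subset_iff by (meson linorder_not_less)
  then show False
    using assms(1,2) psubset_card_mono[of T T'] by (simp add: is_top_set_def)
qed

text \<open>Dual counting argument: a set \<open>T'\<close> containing \<open>j\<close> would have
  to contain all of \<open>T\<close> as well.\<close>

lemma is_top_set_not_memI:
  fixes w :: "real ^ 'g::finite"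
  assumes "is_top_set K w T'" and "card T = K" and "j \<notin> T" and "\<And>a. a \<in> T \<Longrightarrow> w $ j < w $ a"
  shows "j \<notin> T'"
proof
  assume "j \<in> T'"
  with assms have "T \<subset> T'"
    unfolding is_top_set_def psubset_eq subset_iff by (meson linorder_not_less)
  then show False
    using assms(1,2) psubset_card_mono[of T' T] by (simp add: is_top_set_def)
qed

text \<open>The finitely many strict inequalities between coordinates of \<open>v\<close> eventually
  hold for \<open>w n\<close> too. Thus \<open>T n\<close> can differ from other Top-K sets of
  \<open>v\<close> only in how it resolves ties of \<open>v\<close>.\<close>

lemma eventually_is_top_set_limit:
  fixes w :: "nat \<Rightarrow> real ^ 'g::finite"
  assumes "w \<longlonglongrightarrow> v" and "\<And>n. is_top_set K (w n) (T n)"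
  shows "\<forall>\<^sub>F n in sequentially. is_top_set K v (T n)"
proof -
  have "\<forall>\<^sub>F n in sequentially. v $ a < v $ b \<longrightarrow> w n $ a < w n $ b" for a b
  proof (cases "v $ a < v $ b")
    case True
    then have "\<forall>\<^sub>F n in sequentially. w n $ b - w n $ a > 0"
      by (intro order_tendstoD(1)[where y = "v $ b - v $ a"] tendsto_intros assms(1)) auto
    then show ?thesis by eventually_elim auto
  qed auto
  then have "\<forall>\<^sub>F n in sequentially. \<forall>a b. v $ a < v $ b \<longrightarrow> w n $ a < w n $ b"
    by (intro eventually_all_finite)
  then show ?thesis
  proof eventually_elim
    case (elim n)
    with assms(2)[of n] show ?case
      unfolding is_top_set_def by (meson linorder_not_less)
  qed
qed

section \<open>The tilted latents and their pre-activations\<close>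

text \<open>Every change of a latent is a multiple of \<open>f $ j\<close>, so one coefficient
  function describes the perturbation: latent \<open>i\<close> becomes
  \<open>f $ i + s f $ j\<close>, latent \<open>j\<close> becomes
  \<open>(1 - s) f $ j\<close>.\<close>

definition tilt_coeff :: "'g \<Rightarrow> 'g \<Rightarrow> real \<Rightarrow> 'g \<Rightarrow> real" where
  "tilt_coeff i j s k = (if k = i then s else if k = j then - s else 0)"

definition tilt :: "'g::finite \<Rightarrow> 'g \<Rightarrow> real \<Rightarrow> real ^ 'd ^ 'g \<Rightarrow> real ^ 'd::finite ^ 'g" where
  "tilt i j s f = (\<chi> k. f $ k + tilt_coeff i j s k *\<^sub>R f $ j)"

text \<open>The pre-activations of the tilted latents, expressed through the magnitudes alone;
  \<open>preact_tilt\<close> justifies this for orthonormal features.\<close>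

definition tilt_magn :: "'g::finite \<Rightarrow> 'g \<Rightarrow> real \<Rightarrow> real ^ 'g \<Rightarrow> real ^ 'g" where
  "tilt_magn i j s \<mu> = (\<chi> k. \<mu> $ k + tilt_coeff i j s k * \<mu> $ j)"

definition sq_loss ::
  "(real ^ 'g \<Rightarrow> 'g set) \<Rightarrow> real ^ 'd ^ 'g \<Rightarrow> real ^ 'd::finite \<Rightarrow> real" where
  "sq_loss sel l x = (norm (x - reconstruct sel l x))\<^sup>2"

lemma tilt_0 [simp]: "tilt i j 0 f = f"
  by (simp add: tilt_def tilt_coeff_def vec_eq_iff)

lemma tilt_magn_0 [simp]: "tilt_magn i j 0 \<mu> = \<mu>"
  by (simp add: tilt_magn_def tilt_coeff_def vec_eq_iff)

lemma tendsto_tilt_coeff: "((\<lambda>s. tilt_coeff i j s k) \<longlongrightarrow> 0) (at 0)"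
proof -
  have "((\<lambda>s. s * (if k = i then 1 else if k = j then - 1 else 0)) \<longlongrightarrow>
      0 * (if k = i then 1 else if k = j then - 1 else 0)) (at (0::real))"
    by (intro tendsto_intros)
  then show ?thesis
    by (auto simp: tilt_coeff_def split: if_splits)
qed

lemma tendsto_tilt:
  "((\<lambda>s. tilt i j s (f :: real ^ 'd::finite ^ 'g::finite)) \<longlongrightarrow> f) (at 0)"
proof -
  have "((\<lambda>s. f $ k + tilt_coeff i j s k *\<^sub>R f $ j) \<longlongrightarrow> f $ k + 0 *\<^sub>R f $ j) (at 0)" for k
    by (intro tendsto_intros tendsto_tilt_coeff)
  then show ?thesis
    unfolding tilt_def by - (rule vec_tendstoI, simp)
qed

lemma tendsto_tilt_magn:
  "((\<lambda>s. tilt_magn i j s (\<mu> :: real ^ 'g::finite)) \<longlongrightarrow> \<mu>) (at 0)"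
proof -
  have "((\<lambda>s. \<mu> $ k + tilt_coeff i j s k * \<mu> $ j) \<longlongrightarrow> \<mu> $ k + 0 * \<mu> $ j) (at 0)" for k
    by (intro tendsto_intros tendsto_tilt_coeff)
  then show ?thesis
    unfolding tilt_magn_def by - (rule vec_tendstoI, simp)
qed

section \<open>The loss in orthonormal coordinates, and its expansion in \<open>s\<close>\<close>

lemma orthonormal_family_inner_sum:
  fixes f :: "real ^ 'd::finite ^ 'g::finite"
  assumes "orthonormal_family f"
  shows "f $ k \<bullet> (\<Sum>a\<in>UNIV. c a *\<^sub>R f $ a) = c k"
  using assms
  by (simp only: orthonormal_family_def inner_sum_right inner_scaleR_right)
    (simp add: if_distrib cong: if_cong)

lemma orthonormal_family_norm_sum:
  fixes f :: "real ^ 'd::finite ^ 'g::finite"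
  assumes "orthonormal_family f"
  shows "(norm (\<Sum>a\<in>UNIV. c a *\<^sub>R f $ a))\<^sup>2 = (\<Sum>a\<in>UNIV. (c a)\<^sup>2)"
proof -
  let ?v = "\<Sum>a\<in>UNIV. c a *\<^sub>R f $ a"
  have "(norm ?v)\<^sup>2 = (\<Sum>a\<in>UNIV. c a *\<^sub>R f $ a \<bullet> ?v)"
    unfolding power2_norm_eq_inner by (rule inner_sum_left)
  also have "\<dots> = (\<Sum>a\<in>UNIV. (c a)\<^sup>2)"
    by (simp only: inner_scaleR_left orthonormal_family_inner_sum[OF assms] power2_eq_square)
  finally show ?thesis .
qed

lemma preact_tilt:
  fixes f :: "real ^ 'd::finite ^ 'g::finite"
  assumes "orthonormal_family f"
  shows "preact (tilt i j s f) (\<Sum>k\<in>UNIV. \<mu> $ k *\<^sub>R f $ k) = tilt_magn i j s \<mu>"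
  by (simp add: preact_def tilt_def tilt_magn_def vec_eq_iff inner_add_left
      orthonormal_family_inner_sum[OF assms])

text \<open>The residual stays in the span of the features, so its squared norm is a sum over
  coordinates. A selected latent \<open>k\<close> contributes \<open>t k\<close> along
  \<open>f $ k\<close>; the tilts add only the leakage \<open>s (t i - t j)\<close> along
  \<open>f $ j\<close>.\<close>

lemma sq_loss_tilt:
  fixes f :: "real ^ 'd::finite ^ 'g::finite" and \<mu> :: "real ^ 'g"
    and s :: real and sel :: "real ^ 'g \<Rightarrow> 'g set"
  assumes "orthonormal_family f" and "i \<noteq> j"
  defines "T \<equiv> sel (tilt_magn i j s \<mu>)"
  defines "t \<equiv> \<lambda>k. if k \<in> T then tilt_magn i j s \<mu> $ k else 0"
  shows "sq_loss sel (tilt i j s f) (\<Sum>k\<in>UNIV. \<mu> $ k *\<^sub>R f $ k)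
    = (\<Sum>k\<in>UNIV. (\<mu> $ k - t k - (if k = j then s * (t i - t j) else 0))\<^sup>2)"
proof -
  let ?x = "\<Sum>k\<in>UNIV. \<mu> $ k *\<^sub>R f $ k" and ?l = "tilt i j s f"
  have pre: "?l $ k \<bullet> ?x = tilt_magn i j s \<mu> $ k" for k
    using arg_cong[OF preact_tilt[OF assms(1), of i j s \<mu>], of "\<lambda>v. v $ k"]
    by (simp add: preact_def)
  have coeff: "(\<Sum>k\<in>UNIV. t k * tilt_coeff i j s k) = s * (t i - t j)"
  proof -
    have "(\<Sum>k\<in>UNIV. t k * tilt_coeff i j s k) = (\<Sum>k\<in>{i, j}. t k * tilt_coeff i j s k)"
      by (rule sum.mono_neutral_right) (auto simp: tilt_coeff_def)
    with \<open>i \<noteq> j\<close> show ?thesis by (simp add: tilt_coeff_def algebra_simps)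
  qed
  have "reconstruct sel ?l ?x = (\<Sum>k\<in>T. tilt_magn i j s \<mu> $ k *\<^sub>R ?l $ k)"
    by (simp add: reconstruct_def fired_def preact_tilt[OF assms(1)] pre T_def)
  also have "\<dots> = (\<Sum>k\<in>UNIV. t k *\<^sub>R ?l $ k)"
    by (rule sum.mono_neutral_cong_left) (auto simp: t_def)
  also have "\<dots> = (\<Sum>k\<in>UNIV. t k *\<^sub>R f $ k) + (\<Sum>k\<in>UNIV. t k * tilt_coeff i j s k) *\<^sub>R f $ j"
    by (simp add: tilt_def scaleR_add_right sum.distrib scaleR_sum_left)
  also have "(\<Sum>k\<in>UNIV. t k * tilt_coeff i j s k) *\<^sub>R f $ j
      = (\<Sum>k\<in>UNIV. (if k = j then s * (t i - t j) else 0) *\<^sub>R f $ k)"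
    by (simp add: coeff if_distrib[where f = "\<lambda>c. c *\<^sub>R _"] cong: if_cong)
  finally have "?x - reconstruct sel ?l ?x
      = (\<Sum>k\<in>UNIV. (\<mu> $ k - t k - (if k = j then s * (t i - t j) else 0)) *\<^sub>R f $ k)"
    by (simp add: scaleR_diff_left sum_subtractf)
  then show ?thesis
    by (simp add: sq_loss_def orthonormal_family_norm_sum[OF assms(1)])
qed

lemma sq_loss_disentangled:
  fixes f :: "real ^ 'd::finite ^ 'g::finite" and \<mu> :: "real ^ 'g"
  assumes "orthonormal_family f" and "i \<noteq> (j :: 'g)"
  shows "sq_loss sel f (\<Sum>k\<in>UNIV. \<mu> $ k *\<^sub>R f $ k) = (\<Sum>k\<in>- sel \<mu>. (\<mu> $ k)\<^sup>2)"
proof -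
  have "sq_loss sel f (\<Sum>k\<in>UNIV. \<mu> $ k *\<^sub>R f $ k)
      = (\<Sum>k\<in>UNIV. (\<mu> $ k - (if k \<in> sel \<mu> then \<mu> $ k else 0))\<^sup>2)"
    using sq_loss_tilt[OF assms, of sel 0 \<mu>] by (simp cong: if_cong)
  also have "\<dots> = (\<Sum>k\<in>- sel \<mu>. (\<mu> $ k)\<^sup>2)"
    by (rule sum.mono_neutral_cong_right) auto
  finally show ?thesis .
qed

text \<open>For whatever set \<open>T\<close> is selected, only the residual coordinates
  \<open>i\<close> and \<open>j\<close> differ from those of the untilted latents with the same
  \<open>T\<close>. A first-order term survives only if \<open>i\<close> fires and \<open>j\<close>
  does not; the four membership cases are computed separately.\<close>

lemma sq_loss_tilt_le:
  fixes f :: "real ^ 'd::finite ^ 'g::finite" and \<mu> :: "real ^ 'g"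
    and s :: real and sel :: "real ^ 'g \<Rightarrow> 'g set"
  assumes "orthonormal_family f" and "i \<noteq> j" and "0 \<le> s" "s \<le> 1"
  defines "T \<equiv> sel (tilt_magn i j s \<mu>)"
  shows "sq_loss sel (tilt i j s f) (\<Sum>k\<in>UNIV. \<mu> $ k *\<^sub>R f $ k)
    \<le> (\<Sum>k\<in>- T. (\<mu> $ k)\<^sup>2) - (if i \<in> T \<and> j \<notin> T then 2 * s * (\<mu> $ i * \<mu> $ j) else 0)
      + 9 * s\<^sup>2 * (\<Sum>k\<in>UNIV. (\<mu> $ k)\<^sup>2)"
proof -
  define t where "t = (\<lambda>k. if k \<in> T then tilt_magn i j s \<mu> $ k else 0)"
  define e where "e = (\<lambda>k. \<mu> $ k - t k - (if k = j then s * (t i - t j) else 0))"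
  define p q where "p = \<mu> $ i" and "q = \<mu> $ j"
  have sq: "(a + b)\<^sup>2 \<le> 2 * a\<^sup>2 + 2 * b\<^sup>2" for a b :: real
    using zero_le_power2[of "a - b"] by (simp add: power2_eq_square algebra_simps)
  have ti: "t i = (if i \<in> T then p + s * q else 0)"
    and tj: "t j = (if j \<in> T then q - s * q else 0)"
    using \<open>i \<noteq> j\<close> by (simp_all add: t_def tilt_magn_def tilt_coeff_def p_def q_def)
  have s1: "s\<^sup>2 \<le> 1" "(1 - s)\<^sup>2 \<le> 1" "(2 - s)\<^sup>2 \<le> 2\<^sup>2"
    using assms(3,4) power_mono[of "2 - s" 2 2] by (auto simp: power_le_one_iff)
  \<comment> \<open>The excess of the squared residual in coordinate \<open>k\<close> over its
    untilted value for the same \<open>T\<close>; it vanishes outside \<open>{i, j}\<close>.\<close>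
  let ?d = "\<lambda>k. (e k)\<^sup>2 - (if k \<in> T then 0 else (\<mu> $ k)\<^sup>2)"
  have pq: "p\<^sup>2 + q\<^sup>2 \<le> (\<Sum>k\<in>UNIV. (\<mu> $ k)\<^sup>2)"
    using sum_mono2[of UNIV "{i, j}" "\<lambda>k. (\<mu> $ k)\<^sup>2"] \<open>i \<noteq> j\<close> by (simp add: p_def q_def)
  have "?d i + ?d j \<le> - (if i \<in> T \<and> j \<notin> T then 2 * s * (p * q) else 0) + s\<^sup>2 * (9 * (p\<^sup>2 + q\<^sup>2))"
  proof -
    consider "i \<in> T" "j \<notin> T" | "i \<in> T" "j \<in> T" | "i \<notin> T" "j \<in> T" | "i \<notin> T" "j \<notin> T"
      by blast
    then show ?thesis
    proof cases
      case 1
      \<comment> \<open>Here \<open>e i = - s q\<close> and \<open>e j = q - s (p + s q)\<close>: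
        the leakage of latent \<open>i\<close> recovers part of the missing feature
        \<open>j\<close>, and the cross term in the square of \<open>e j\<close> is the
        gain.\<close>
      have "?d i + ?d j = - 2 * s * (p * q) + s\<^sup>2 * ((p + s * q)\<^sup>2 - q\<^sup>2)"
        using 1 \<open>i \<noteq> j\<close> by (simp add: e_def ti tj flip: p_def q_def)
          (simp add: power2_eq_square algebra_simps)
      also have "(p + s * q)\<^sup>2 - q\<^sup>2 \<le> 9 * (p\<^sup>2 + q\<^sup>2)"
        using sq[of p "s * q"] mult_right_mono[OF s1(1), of "q\<^sup>2"]
        by (simp add: power_mult_distrib) (smt (verit) zero_le_power2)
      finally show ?thesis
        using 1 by (simp add: mult_left_mono)
    next
      case 2
      \<comment> \<open>Now \<open>e i = - s q\<close> and \<open>e j = s (2 (1 - s) q - p)\<close>,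
        so nothing of first order remains. The estimate
        \<open>8 q\<^sup>2 + 2 p\<^sup>2 + q\<^sup>2\<close> in this case is where the constant 9
        comes from.\<close>
      have "?d i + ?d j = s\<^sup>2 * ((2 * ((1 - s) * q) + - p)\<^sup>2 + q\<^sup>2)"
        using 2 \<open>i \<noteq> j\<close> by (simp add: e_def ti tj flip: p_def q_def)
          (simp add: power2_eq_square algebra_simps)
      also have "(2 * ((1 - s) * q) + - p)\<^sup>2 + q\<^sup>2 \<le> 9 * (p\<^sup>2 + q\<^sup>2)"
        using sq[of "2 * ((1 - s) * q)" "- p"] mult_right_mono[OF s1(2), of "q\<^sup>2"]
        by (simp add: power_mult_distrib) (smt (verit) zero_le_power2)
      finally show ?thesis
        using 2 by (simp add: mult_left_mono)
    next
      case 3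
      have "?d i + ?d j = s\<^sup>2 * ((2 - s)\<^sup>2 * q\<^sup>2)"
        using 3 \<open>i \<noteq> j\<close> by (simp add: e_def ti tj flip: p_def q_def)
          (simp add: power2_eq_square algebra_simps)
      also have "(2 - s)\<^sup>2 * q\<^sup>2 \<le> 9 * (p\<^sup>2 + q\<^sup>2)"
        using mult_right_mono[OF s1(3), of "q\<^sup>2"] by simp (smt (verit) zero_le_power2)
      finally show ?thesis
        using 3 by (simp add: mult_left_mono)
    next
      case 4
      then have "?d i + ?d j = 0"
        using \<open>i \<noteq> j\<close> by (simp add: e_def ti tj flip: p_def q_def)
      with 4 show ?thesis by simp
    qed
  qed
  also have "\<dots> \<le> - (if i \<in> T \<and> j \<notin> T then 2 * s * (p * q) else 0)
      + 9 * s\<^sup>2 * (\<Sum>k\<in>UNIV. (\<mu> $ k)\<^sup>2)"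
    using mult_left_mono[OF pq, of "9 * s\<^sup>2"] by (simp only: mult_ac) simp
  finally have le: "?d i + ?d j \<le> \<dots>" .
  have "(\<Sum>k\<in>UNIV. ?d k) = (\<Sum>k\<in>{i, j}. ?d k)"
    by (rule sum.mono_neutral_right) (auto simp: e_def t_def tilt_magn_def tilt_coeff_def)
  moreover have "(\<Sum>k\<in>UNIV. if k \<in> T then 0 else (\<mu> $ k)\<^sup>2) = (\<Sum>k\<in>- T. (\<mu> $ k)\<^sup>2)"
    by (rule sum.mono_neutral_cong_right) auto
  ultimately have "(\<Sum>k\<in>UNIV. (e k)\<^sup>2) = (\<Sum>k\<in>- T. (\<mu> $ k)\<^sup>2) + (?d i + ?d j)"
    using \<open>i \<noteq> j\<close> by (simp add: sum_subtractf)
  moreover have "sq_loss sel (tilt i j s f) (\<Sum>k\<in>UNIV. \<mu> $ k *\<^sub>R f $ k) = (\<Sum>k\<in>UNIV. (e k)\<^sup>2)"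
    unfolding sq_loss_tilt[OF assms(1,2)] e_def t_def T_def ..
  ultimately show ?thesis
    using le unfolding p_def q_def by linarith
qed

section \<open>A linear bound uniform in the input\<close>

lemma sum_Compl_squares:
  fixes \<mu> :: "real ^ 'g::finite"
  shows "(\<Sum>k\<in>- T. (\<mu> $ k)\<^sup>2) = (\<Sum>k\<in>UNIV. (\<mu> $ k)\<^sup>2) - (\<Sum>k\<in>T. (\<mu> $ k)\<^sup>2)"
  by (simp add: Compl_eq_Diff_UNIV sum_diff)

lemma tilt_magn_nonneg:
  assumes "\<And>k. 0 \<le> \<mu> $ k" and "0 \<le> s" "s \<le> 1"
  shows "0 \<le> tilt_magn i j s \<mu> $ k"
  using assms mult_right_mono[OF assms(3), of "\<mu> $ j"]
  by (auto simp: tilt_magn_def tilt_coeff_def intro!: add_nonneg_nonneg)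

text \<open>Coordinate \<open>i\<close> changes by at most
  \<open>s (p\<^sup>2 + 2 q\<^sup>2)\<close> and coordinate \<open>j\<close> by at most
  \<open>2 s q\<^sup>2\<close>; the others are fixed. As \<open>T\<close> is arbitrary, energies of
  the sets selected before and after the tilt can be compared.\<close>

lemma sum_tilt_magn_squares_close:
  fixes \<mu> :: "real ^ 'g::finite"
  assumes "i \<noteq> j" and "0 \<le> s" "s \<le> 1"
  shows "\<bar>(\<Sum>k\<in>T. (tilt_magn i j s \<mu> $ k)\<^sup>2) - (\<Sum>k\<in>T. (\<mu> $ k)\<^sup>2)\<bar> \<le> 4 * s * (\<Sum>k\<in>UNIV. (\<mu> $ k)\<^sup>2)"
proof -
  define p q where "p = \<mu> $ i" and "q = \<mu> $ j"
  let ?d = "\<lambda>k. \<bar>(tilt_magn i j s \<mu> $ k)\<^sup>2 - (\<mu> $ k)\<^sup>2\<bar>"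
  have pq: "p\<^sup>2 + q\<^sup>2 \<le> (\<Sum>k\<in>UNIV. (\<mu> $ k)\<^sup>2)"
    using sum_mono2[of UNIV "{i, j}" "\<lambda>k. (\<mu> $ k)\<^sup>2"] assms(1) by (simp add: p_def q_def)
  have s2: "s * q\<^sup>2 \<le> 1 * q\<^sup>2"
    using assms(3) by (intro mult_right_mono) auto
  have sq0: "0 \<le> s * q\<^sup>2"
    using assms(2) by simp
  have "(tilt_magn i j s \<mu> $ i)\<^sup>2 - (\<mu> $ i)\<^sup>2 = s * (2 * (p * q) + s * q\<^sup>2)"
    by (simp add: tilt_magn_def tilt_coeff_def p_def q_def power2_eq_square algebra_simps)
  then have "?d i = s * \<bar>2 * (p * q) + s * q\<^sup>2\<bar>"
    using assms(2) by (simp add: abs_mult)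
  also have "\<bar>2 * (p * q) + s * q\<^sup>2\<bar> \<le> p\<^sup>2 + 2 * q\<^sup>2"
    using s2 sq0 zero_le_power2[of "p - q"] zero_le_power2[of "p + q"]
    unfolding power2_diff power2_sum mult.assoc abs_le_iff by linarith
  finally have di: "?d i \<le> s * (p\<^sup>2 + 2 * q\<^sup>2)"
    using assms(2) by (simp add: mult_left_mono)
  have "(tilt_magn i j s \<mu> $ j)\<^sup>2 - (\<mu> $ j)\<^sup>2 = s * (s * q\<^sup>2 - 2 * q\<^sup>2)"
    using assms(1)
    by (simp add: tilt_magn_def tilt_coeff_def q_def power2_eq_square algebra_simps)
  then have "?d j = s * \<bar>s * q\<^sup>2 - 2 * q\<^sup>2\<bar>"
    using assms(2) by (simp add: abs_mult)
  also have "\<dots> \<le> s * (2 * q\<^sup>2)"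
    using assms(2) s2 sq0 by (intro mult_left_mono) linarith+
  finally have dj: "?d j \<le> s * (2 * q\<^sup>2)" .
  have "\<bar>(\<Sum>k\<in>T. (tilt_magn i j s \<mu> $ k)\<^sup>2) - (\<Sum>k\<in>T. (\<mu> $ k)\<^sup>2)\<bar> \<le> (\<Sum>k\<in>T. ?d k)"
    unfolding sum_subtractf[symmetric] by (rule sum_abs)
  also have "\<dots> \<le> (\<Sum>k\<in>UNIV. ?d k)"
    by (rule sum_mono2) auto
  also have "\<dots> = (\<Sum>k\<in>{i, j}. ?d k)"
    by (rule sum.mono_neutral_right) (auto simp: tilt_magn_def tilt_coeff_def)
  also have "\<dots> = ?d i + ?d j"
    using assms(1) by simp
  also have "\<dots> \<le> s * (p\<^sup>2 + 2 * q\<^sup>2 + 2 * q\<^sup>2)"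
    using di dj by (simp add: distrib_left)
  also have "\<dots> \<le> s * (4 * (p\<^sup>2 + q\<^sup>2))"
    using assms(2) by (intro mult_left_mono) auto
  also have "\<dots> \<le> 4 * s * (\<Sum>k\<in>UNIV. (\<mu> $ k)\<^sup>2)"
    using mult_left_mono[OF pq, of "4 * s"] assms(2) by (simp add: distrib_left mult_ac)
  finally show ?thesis .
qed

text \<open>Provides the dominating function for the difference quotients, so it must hold for all
  \<open>s\<close> in the unit interval and not only for small \<open>s\<close> depending on the
  input. The constant is \<open>17 = 8 + 9\<close>: 8 for the change of selection, 9 for the
  quadratic remainder with \<open>s\<^sup>2 \<le> s\<close>.\<close>

lemma sq_loss_tilt_le_linear:
  fixes f :: "real ^ 'd::finite ^ 'g::finite" and \<mu> :: "real ^ 'g"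
  assumes "orthonormal_family f" and "i \<noteq> j" and "0 \<le> s" "s \<le> 1"
    and top: "\<And>v. is_top_set K v (sel v)" and nonneg: "\<And>k. 0 \<le> \<mu> $ k"
  shows "sq_loss sel (tilt i j s f) (\<Sum>k\<in>UNIV. \<mu> $ k *\<^sub>R f $ k)
    \<le> sq_loss sel f (\<Sum>k\<in>UNIV. \<mu> $ k *\<^sub>R f $ k) + 17 * s * (\<Sum>k\<in>UNIV. (\<mu> $ k)\<^sup>2)"
proof -
  let ?w = "tilt_magn i j s \<mu>" and ?S = "\<Sum>k\<in>UNIV. (\<mu> $ k)\<^sup>2"
  \<comment> \<open>The new selection is optimal for the tilted magnitudes; passing back to
    \<open>\<mu>\<close> costs \<open>4 s\<close> times the total energy on each side, hence the
    8.\<close>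
  have "(\<Sum>k\<in>sel \<mu>. (?w $ k)\<^sup>2) \<le> (\<Sum>k\<in>sel ?w. (?w $ k)\<^sup>2)"
    using top[of \<mu>] assms(3,4) nonneg
    by (intro is_top_set_sum_squares_mono[OF top] tilt_magn_nonneg) (auto simp: is_top_set_def)
  then have "(\<Sum>k\<in>- sel ?w. (\<mu> $ k)\<^sup>2) \<le> (\<Sum>k\<in>- sel \<mu>. (\<mu> $ k)\<^sup>2) + 8 * s * ?S"
    using sum_tilt_magn_squares_close[OF assms(2-4), where T = "sel ?w" and \<mu> = \<mu>]
      sum_tilt_magn_squares_close[OF assms(2-4), where T = "sel \<mu>" and \<mu> = \<mu>]
    unfolding sum_Compl_squares by linarith
  moreover have "9 * s\<^sup>2 * ?S \<le> 9 * s * ?S"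
    using assms(3,4) by (intro mult_right_mono sum_nonneg)
      (auto simp: power2_eq_square mult_left_le)
  moreover have "0 \<le> 2 * s * (\<mu> $ i * \<mu> $ j)"
    using assms(3) nonneg by simp
  ultimately show ?thesis
    using sq_loss_tilt_le[OF assms(1-4), of sel \<mu>]
    unfolding sq_loss_disentangled[OF assms(1,2)] by (simp split: if_splits)
qed

section \<open>First-order decrease for a fixed input\<close>

text \<open>The tilt lifts entry \<open>i\<close> strictly above everything outside \<open>T\<close>
  and pushes entry \<open>j\<close> strictly below everything in \<open>T\<close>, for every
  positive \<open>s\<close>. Ties that \<open>i\<close> won or \<open>j\<close> lost therefore stay
  that way under any rule.\<close>

lemma tilt_magn_separates:
  fixes \<mu> :: "real ^ 'g::finite"
  assumes "is_top_set K \<mu> T" and "is_top_set K (tilt_magn i j s \<mu>) T'"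
    and "i \<in> T" "j \<notin> T" "0 < \<mu> $ j" "0 < s"
  shows "i \<in> T' \<and> j \<notin> T'"
proof
  have pos: "0 < s * \<mu> $ j" and ij: "i \<noteq> j"
    using assms by auto
  have le: "\<mu> $ b \<le> \<mu> $ a" if "a \<in> T" "b \<notin> T" for a b
    using assms(1) that by (simp add: is_top_set_def)
  show "i \<in> T'"
    using assms(1,2,3) pos ij le[OF \<open>i \<in> T\<close>]
    by (intro is_top_set_memI[OF assms(2), of T])
      (force simp: is_top_set_def tilt_magn_def tilt_coeff_def)+
  show "j \<notin> T'"
    using assms(1,2,4) pos ij le[OF _ \<open>j \<notin> T\<close>]
    by (intro is_top_set_not_memI[OF assms(2), of T])
      (force simp: is_top_set_def tilt_magn_def tilt_coeff_def)+
qed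

text \<open>Once the tilted selection is a Top-K set of \<open>\<mu>\<close>, it leaves out no more
  energy than \<open>sel \<mu>\<close>, so the change of selection costs nothing and the linear
  error of the uniform bound disappears. How soon this happens depends on
  \<open>\<mu>\<close>.\<close>

lemma sq_loss_tilt_eventually_le:
  fixes f :: "real ^ 'd::finite ^ 'g::finite" and \<mu> :: "real ^ 'g"
  assumes "orthonormal_family f" and "i \<noteq> j"
    and top: "\<And>v. is_top_set K v (sel v)" and nonneg: "\<And>k. 0 \<le> \<mu> $ k"
    and s: "s \<longlonglongrightarrow> 0" "\<And>n. 0 < s n" "\<And>n. s n \<le> 1"
  shows "\<forall>\<^sub>F n in sequentially. sq_loss sel (tilt i j (s n) f) (\<Sum>k\<in>UNIV. \<mu> $ k *\<^sub>R f $ k)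
    \<le> sq_loss sel f (\<Sum>k\<in>UNIV. \<mu> $ k *\<^sub>R f $ k)
      - s n * (if i \<in> sel \<mu> \<and> 0 < \<mu> $ j \<and> j \<notin> sel \<mu> then 2 * (\<mu> $ i * \<mu> $ j) else 0)
      + 9 * (s n)\<^sup>2 * (\<Sum>k\<in>UNIV. (\<mu> $ k)\<^sup>2)"
proof -
  let ?T = "\<lambda>n. sel (tilt_magn i j (s n) \<mu>)"
  have "filterlim s (at 0) sequentially"
    using s by (intro filterlim_atI) (auto simp: less_imp_neq[THEN not_sym])
  then have "(\<lambda>n. tilt_magn i j (s n) \<mu>) \<longlonglongrightarrow> \<mu>"
    by (rule filterlim_compose[OF tendsto_tilt_magn])
  then have "\<forall>\<^sub>F n in sequentially. is_top_set K \<mu> (?T n)"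
    by (rule eventually_is_top_set_limit) (rule top)
  then show ?thesis
  proof eventually_elim
    case (elim n)
    have "card (sel \<mu>) = K"
      using top[of \<mu>] by (simp add: is_top_set_def)
    then have "(\<Sum>k\<in>sel \<mu>. (\<mu> $ k)\<^sup>2) \<le> (\<Sum>k\<in>?T n. (\<mu> $ k)\<^sup>2)"
      by (intro is_top_set_sum_squares_mono[OF elim] nonneg)
    then have "(\<Sum>k\<in>- ?T n. (\<mu> $ k)\<^sup>2) \<le> (\<Sum>k\<in>- sel \<mu>. (\<mu> $ k)\<^sup>2)"
      by (simp add: sum_Compl_squares)
    \<comment> \<open>On the event, \<open>tilt_magn_separates\<close> keeps \<open>i\<close> in and
      \<open>j\<close> out; off the event the left side is 0 and the right side is
      nonnegative.\<close>
    moreover have "s n * (if i \<in> sel \<mu> \<and> 0 < \<mu> $ j \<and> j \<notin> sel \<mu> then 2 * (\<mu> $ i * \<mu> $ j) else 0)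
        \<le> (if i \<in> ?T n \<and> j \<notin> ?T n then 2 * s n * (\<mu> $ i * \<mu> $ j) else 0)"
      using tilt_magn_separates[OF top[of \<mu>] top[of "tilt_magn i j (s n) \<mu>"]] s(2)[of n] nonneg
      by (auto intro: mult_nonneg_nonneg)
    ultimately show ?case
      using sq_loss_tilt_le[OF assms(1,2) less_imp_le[OF s(2)] s(3), of sel n \<mu>]
      unfolding sq_loss_disentangled[OF assms(1,2)] by linarith
  qed
qed

section \<open>Measurability of the loss\<close>

lemma borel_measurable_sq_loss:
  fixes l :: "real ^ 'd::finite ^ 'g::finite"
  assumes [measurable]: "x \<in> borel_measurable M" "sel \<in> borel \<rightarrow>\<^sub>M count_space UNIV"
  shows "(\<lambda>\<omega>. sq_loss sel l (x \<omega>)) \<in> borel_measurable M"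
proof -
  have [measurable]: "(\<lambda>\<omega>. preact l (x \<omega>)) \<in> borel_measurable M"
  proof -
    have "continuous_on UNIV (preact l)"
      unfolding preact_def by (intro continuous_intros)
    then show ?thesis
      using assms(1) borel_measurable_continuous_onI measurable_compose by blast
  qed
  have [measurable]: "Measurable.pred M (\<lambda>\<omega>. k \<in> sel (preact l (x \<omega>)))" for k
    by measurable
  \<comment> \<open>Trades the random index set for a fixed one with measurable membership
    conditions.\<close>
  have "reconstruct sel l y = (\<Sum>k\<in>UNIV. if k \<in> sel (preact l y) then (l $ k \<bullet> y) *\<^sub>R l $ k else 0)" for y
    unfolding reconstruct_def fired_def by (rule sum.mono_neutral_cong_left) auto
  then show ?thesis
    unfolding sq_loss_def by simp
qed

section \<open>The expected loss along the tilt\<close>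

theorem theoremF2:
  fixes M :: "'w measure"
    and m :: "'g::finite \<Rightarrow> 'w \<Rightarrow> real"
    and f :: "real ^ 'd::finite ^ 'g"
    and K :: nat
    and sel :: "real ^ 'g \<Rightarrow> 'g set"
    and i j :: 'g
  assumes "prob_space M"
    and "CARD('g) \<ge> 2"
    and "1 \<le> K" and "K \<le> CARD('g)"
    and "orthonormal_family f"
    and "\<And>k. m k \<in> borel_measurable M"
    and "\<And>k. AE \<omega> in M. 0 \<le> m k \<omega>"
    and "\<And>k. integrable M (\<lambda>\<omega>. (m k \<omega>)\<^sup>2)"
    and "topK_rule K sel"
    and "i \<noteq> j"
    and "\<P>(\<omega> in M. i \<in> fired sel f (sae_input m f \<omega>) \<and> m j \<omega> > 0 \<and>
                 j \<notin> fired sel f (sae_input m f \<omega>)) > 0"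
  shows "\<not> local_minimum (expected_mse M (sae_input m f) sel) f"
proof
  assume "local_minimum (expected_mse M (sae_input m f) sel) f"
  then obtain \<epsilon> where \<epsilon>: "0 < \<epsilon>"
    and min: "\<And>l. dist l f < \<epsilon> \<Longrightarrow>
      expected_mse M (sae_input m f) sel f \<le> expected_mse M (sae_input m f) sel l"
    unfolding local_minimum_def by blast
  interpret prob_space M by fact
  note [measurable] = assms(6)
  have top: "is_top_set K v (sel v)" for v
    using assms(9) by (simp add: topK_rule_def)
  have [measurable]: "sel \<in> borel \<rightarrow>\<^sub>M count_space UNIV"
    using assms(9) by (simp add: topK_rule_def)
  define \<mu> where "\<mu> = (\<lambda>\<omega>. \<chi> k. m k \<omega>)"
  define S where "S = (\<lambda>\<omega>. \<Sum>k\<in>UNIV. (\<mu> \<omega> $ k)\<^sup>2)"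
  define loss where "loss = (\<lambda>s \<omega>. sq_loss sel (tilt i j s f) (\<Sum>k\<in>UNIV. \<mu> \<omega> $ k *\<^sub>R f $ k))"
  \<comment> \<open>A lower bound for the rate at which the loss of a fixed input decreases at
    \<open>s = 0\<close>, nonzero only on the event of the hypothesis.\<close>
  define gain where "gain = (\<lambda>\<omega>. if i \<in> sel (\<mu> \<omega>) \<and> 0 < \<mu> \<omega> $ j \<and> j \<notin> sel (\<mu> \<omega>)
    then 2 * (\<mu> \<omega> $ i * \<mu> \<omega> $ j) else 0)"
  define s where "s = (\<lambda>n. 1 / real (Suc n))"
  \<comment> \<open>The available estimates bound the difference quotient from above only. Its
    positive part after adding \<open>gain\<close> is bounded on both sides, so dominated
    convergence applies.\<close>
  define P where "P = (\<lambda>n \<omega>. max 0 ((loss (s n) \<omega> - loss 0 \<omega>) / s n + gain \<omega>))"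

  have s_lim: "s \<longlonglongrightarrow> 0" and s_pos: "0 < s n" and s_le: "s n \<le> 1" for n
    unfolding s_def using LIMSEQ_inverse_real_of_nat by (auto simp: inverse_eq_divide)
  have input: "sae_input m f \<omega> = (\<Sum>k\<in>UNIV. \<mu> \<omega> $ k *\<^sub>R f $ k)" for \<omega>
    by (simp add: sae_input_def \<mu>_def)
  have mse: "expected_mse M (sae_input m f) sel (tilt i j t f) = (\<integral>\<omega>. loss t \<omega> \<partial>M)" for t
    by (simp add: expected_mse_def sq_loss_def loss_def input)
  have fired: "fired sel f (sae_input m f \<omega>) = sel (\<mu> \<omega>)" for \<omega>
    using preact_tilt[OF assms(5), of i j 0] by (simp add: fired_def input)
  have AE_nonneg: "AE \<omega> in M. \<forall>k. 0 \<le> \<mu> \<omega> $ k"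
    using assms(7) by (simp add: \<mu>_def AE_all_countable)

  have [measurable]: "\<mu> \<in> borel_measurable M"
    unfolding \<mu>_def
    by (subst borel_measurable_euclidean_space) (auto simp: Basis_vec_def inner_axis)
  have [measurable]: "(\<lambda>\<omega>. \<mu> \<omega> $ k) \<in> borel_measurable M" for k
    unfolding \<mu>_def by simp
  have [measurable]: "loss t \<in> borel_measurable M" for t
    unfolding loss_def by (rule borel_measurable_sq_loss) measurable
  have [measurable]: "S \<in> borel_measurable M"
    unfolding S_def by measurable
  have [measurable]: "Measurable.pred M (\<lambda>\<omega>. k \<in> sel (\<mu> \<omega>))" for k
    by measurable
  have [measurable]: "gain \<in> borel_measurable M"
    unfolding gain_def by measurable
  have [measurable]: "P n \<in> borel_measurable M" for n
    unfolding P_def by measurable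

  have int_S: "integrable M S"
    unfolding S_def \<mu>_def using assms(8) by simp
  have loss_0: "loss 0 \<omega> = (\<Sum>k\<in>- sel (\<mu> \<omega>). (\<mu> \<omega> $ k)\<^sup>2)" for \<omega>
    using sq_loss_disentangled[OF assms(5,10)] by (simp add: loss_def)
  have loss_0_le: "loss 0 \<omega> \<le> S \<omega>" for \<omega>
    unfolding loss_0 S_def by (rule sum_mono2) auto
  have loss_nonneg: "0 \<le> loss t \<omega>" for t \<omega>
    by (simp add: loss_def sq_loss_def)
  have S_nonneg: "0 \<le> S \<omega>" for \<omega>
    by (simp add: S_def sum_nonneg)
  have loss_le: "AE \<omega> in M. loss (s n) \<omega> \<le> loss 0 \<omega> + 17 * s n * S \<omega>" for n
    using AE_nonneg
  proof eventually_elim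
    case (elim \<omega>)
    then show ?case
      using sq_loss_tilt_le_linear[OF assms(5,10) less_imp_le[OF s_pos] s_le top, of "\<mu> \<omega>" n]
      by (simp add: loss_def S_def)
  qed
  have int_loss: "integrable M (loss (s n))" for n
  proof (rule Bochner_Integration.integrable_bound[of M "\<lambda>\<omega>. S \<omega> + 17 * s n * S \<omega>"])
    show "integrable M (\<lambda>\<omega>. S \<omega> + 17 * s n * S \<omega>)"
      using int_S by simp
    show "AE \<omega> in M. norm (loss (s n) \<omega>) \<le> norm (S \<omega> + 17 * s n * S \<omega>)"
      using loss_le[of n]
    proof eventually_elim
      case (elim \<omega>)
      with loss_0_le[of \<omega>] loss_nonneg[of "s n" \<omega>] show ?case by simp
    qed
  qed simp
  have int_loss_0: "integrable M (loss 0)"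
    by (rule Bochner_Integration.integrable_bound[OF int_S])
      (use loss_0_le loss_nonneg S_nonneg in auto)
  have gain_bound: "\<bar>gain \<omega>\<bar> \<le> S \<omega>" for \<omega>
  proof -
    have "(\<mu> \<omega> $ i)\<^sup>2 + (\<mu> \<omega> $ j)\<^sup>2 \<le> S \<omega>"
      using sum_mono2[of UNIV "{i, j}" "\<lambda>k. (\<mu> \<omega> $ k)\<^sup>2"] assms(10) by (simp add: S_def)
    moreover have "\<bar>2 * (\<mu> \<omega> $ i * \<mu> \<omega> $ j)\<bar> \<le> (\<mu> \<omega> $ i)\<^sup>2 + (\<mu> \<omega> $ j)\<^sup>2"
      using zero_le_power2[of "\<mu> \<omega> $ i - \<mu> \<omega> $ j"] zero_le_power2[of "\<mu> \<omega> $ i + \<mu> \<omega> $ j"]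
      by (simp add: power2_diff power2_sum abs_le_iff)
    ultimately show ?thesis
      using S_nonneg[of \<omega>] by (auto simp: gain_def)
  qed
  have int_gain: "integrable M gain"
    by (rule Bochner_Integration.integrable_bound[OF int_S])
      (use gain_bound S_nonneg in auto)

  \<comment> \<open>Here 18 is 17 from the linear bound plus 1 from
    \<open>gain_bound\<close>.\<close>
  have P_bound: "AE \<omega> in M. norm (P n \<omega>) \<le> 18 * S \<omega>" for n
    using loss_le[of n]
  proof eventually_elim
    case (elim \<omega>)
    then have "(loss (s n) \<omega> - loss 0 \<omega>) / s n \<le> 17 * S \<omega>"
      using s_pos[of n] by (simp add: divide_simps algebra_simps)
    with gain_bound[of \<omega>] S_nonneg[of \<omega>] show ?case
      by (simp add: P_def)
  qed
  \<comment> \<open>Division by \<open>s n\<close> turns the quadratic remainder into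
    \<open>9 * s n * S \<omega>\<close>, which tends to 0 for each fixed
    \<open>\<omega>\<close>.\<close>
  have P_lim: "AE \<omega> in M. (\<lambda>n. P n \<omega>) \<longlonglongrightarrow> 0"
    using AE_nonneg
  proof eventually_elim
    case (elim \<omega>)
    have "\<forall>\<^sub>F n in sequentially.
        loss (s n) \<omega> \<le> loss 0 \<omega> - s n * gain \<omega> + 9 * (s n)\<^sup>2 * S \<omega>"
      using sq_loss_tilt_eventually_le[OF assms(5,10) top _ s_lim s_pos s_le, of "\<mu> \<omega>"] elim
      by (simp add: loss_def gain_def S_def)
    then have "\<forall>\<^sub>F n in sequentially. P n \<omega> \<le> 9 * s n * S \<omega>"
    proof eventually_elim
      case (elim n)
      then have "(loss (s n) \<omega> - loss 0 \<omega>) / s n \<le> 9 * s n * S \<omega> - gain \<omega>"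
        using s_pos[of n] by (simp add: divide_simps algebra_simps power2_eq_square)
      with s_pos[of n] S_nonneg[of \<omega>] show ?case
        by (simp add: P_def)
    qed
    moreover have "(\<lambda>n. 9 * s n * S \<omega>) \<longlonglongrightarrow> 9 * 0 * S \<omega>"
      by (intro tendsto_intros s_lim)
    ultimately show ?case
      by (intro tendsto_sandwich[OF _ _ tendsto_const, of 0 "\<lambda>n. P n \<omega>"]) (auto simp: P_def)
  qed
  have int_P: "integrable M (P n)" for n
    by (rule integrable_dominated_convergence2[where f = "\<lambda>\<omega>. 0" and s = P and w = "\<lambda>\<omega>. 18 * S \<omega>"])
      (use P_lim P_bound int_S in auto)
  have "(\<lambda>n. \<integral>\<omega>. P n \<omega> \<partial>M) \<longlonglongrightarrow> (\<integral>\<omega>. 0 \<partial>M)"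
    by (rule integral_dominated_convergence[where w = "\<lambda>\<omega>. 18 * S \<omega>"])
      (use P_lim P_bound int_S in auto)
  then have int_P_lim: "(\<lambda>n. \<integral>\<omega>. P n \<omega> \<partial>M) \<longlonglongrightarrow> 0"
    by simp

  \<comment> \<open>Feature \<open>i\<close> is active as well: being selected ahead of
    \<open>j\<close>, it has magnitude at least \<open>\<mu> \<omega> $ j > 0\<close>.\<close>
  have gain_pos: "0 < gain \<omega>" if "i \<in> sel (\<mu> \<omega>)" "0 < \<mu> \<omega> $ j" "j \<notin> sel (\<mu> \<omega>)" for \<omega>
  proof -
    have "\<mu> \<omega> $ j \<le> \<mu> \<omega> $ i"
      using top[of "\<mu> \<omega>"] that by (simp add: is_top_set_def)
    with that show ?thesis by (simp add: gain_def)
  qed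
  have gain_nonneg: "0 \<le> gain \<omega>" for \<omega>
    using gain_pos[of \<omega>] by (auto simp: gain_def split: if_splits)
  have "0 < (\<integral>\<omega>. gain \<omega> \<partial>M)"
  proof (rule ccontr)
    assume "\<not> 0 < (\<integral>\<omega>. gain \<omega> \<partial>M)"
    then have "(\<integral>\<omega>. gain \<omega> \<partial>M) = 0"
      using gain_nonneg by (simp add: integral_nonneg order.antisym not_less)
    \<comment> \<open>A nonnegative function with zero integral vanishes almost everywhere, which
      would make the event of the hypothesis a null set.\<close>
    then have "AE \<omega> in M. gain \<omega> = 0"
      using integral_nonneg_eq_0_iff_AE[OF int_gain] gain_nonneg by auto
    then have "AE \<omega> in M. \<not> (i \<in> fired sel f (sae_input m f \<omega>) \<and> m j \<omega> > 0 \<and>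
        j \<notin> fired sel f (sae_input m f \<omega>))"
      by eventually_elim (use gain_pos in \<open>fastforce simp: fired \<mu>_def\<close>)
    then show False
      using assms(11) by (simp add: prob_eq_0_AE)
  qed
  then have "\<forall>\<^sub>F n in sequentially. (\<integral>\<omega>. P n \<omega> \<partial>M) < (\<integral>\<omega>. gain \<omega> \<partial>M)"
    by (rule order_tendstoD(2)[OF int_P_lim])
  moreover have "filterlim s (at 0) sequentially"
    using s_lim s_pos by (intro filterlim_atI) (auto simp: less_imp_neq[THEN not_sym])
  then have "(\<lambda>n. tilt i j (s n) f) \<longlonglongrightarrow> f"
    by (rule filterlim_compose[OF tendsto_tilt])
  then have "\<forall>\<^sub>F n in sequentially. dist (tilt i j (s n) f) f < \<epsilon>"
    by (rule tendstoD) (rule \<epsilon>)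
  ultimately have "\<forall>\<^sub>F n in sequentially. False"
  proof eventually_elim
    case (elim n)
    have "(\<integral>\<omega>. loss 0 \<omega> \<partial>M) \<le> (\<integral>\<omega>. loss (s n) \<omega> \<partial>M)"
      using min[OF elim(2)] by (simp add: mse flip: mse[of 0])
    then have "0 \<le> (\<integral>\<omega>. (loss (s n) \<omega> - loss 0 \<omega>) / s n \<partial>M)"
      using s_pos[of n] int_loss int_loss_0 by simp
    \<comment> \<open>The quotient is at most its positive part after the shift by
      \<open>gain\<close>; the resulting integral is negative for large \<open>n\<close>, against
      minimality.\<close>
    also have "\<dots> \<le> (\<integral>\<omega>. P n \<omega> - gain \<omega> \<partial>M)"
      using int_P int_gain int_loss int_loss_0
      by (intro integral_mono) (auto simp: P_def)
    also have "\<dots> = (\<integral>\<omega>. P n \<omega> \<partial>M) - (\<integral>\<omega>. gain \<omega> \<partial>M)"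
      using int_P int_gain by simp
    finally show False
      using elim(1) by simp
  qed
  then show False by simp
qed

end
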